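(* Let $S: z=z(u,v)$, $(u,v)\in\mathcal{D}$, be a Weingarten surface in $\mathbb{R}^3$ and let $(u,v)$ be natural principal parameters of $S$. Then $(u,v)$ are natural principal parameters for every parallel surface $\bar S(a)$, $a=\mathrm{const}\neq0$, of $S$.
   Context: Surfaces are sufficiently smooth, $S: z=z(u,v)$, $(u,v)\in\mathcal{D}$ ($\mathcal D\subset\mathbb{R}^2$ open and connected), in Euclidean $\mathbb{R}^3$, without umbilical points, parameterized by principal parameters (the coefficients of the first and second fundamental forms satisfy $F=M=0$). With unit normal $l$, the principal curvatures are $\nu_1=L/E$, $\nu_2=N/G$, and $\nu_1-\nu_2>0$. Weingarten surface: there are differentiable functions $f,g$ on an interval with $f-g\neq0$, $f'g'\neq0$ and a function $\nu(u,v)$ with $(\nu_u,\nu_v)\neq(0,0)$ on $\mathcal D$ such that $\nu_1=f(\nu)$, $\nu_2=g(\nu)$; $f,g$ are called Weingarten functions. Natural principal parameters: on a Weingarten surface with principal parameters $(u,v)$ the function $\sqrt E\exp\left(\int\frac{f'd\nu}{f-g}\right)$ depends only on $u$ and $\sqrt G\exp\left(\int\frac{g'd\nu}{g-f}\right)$ depends only on $v$ (antiderivatives in $\nu$ on the interval $\nu(\mathcal D)$, evaluated at $\nu=\nu(u,v)$); the principal parameters are called natural principal if both these functions are constant. Parallel surface: $\bar S(a): \bar z(u,v)=z(u,v)+a\,l(u,v)$, with the same parameters $(u,v)$, where the points with $(1-a\nu_1)(1-a\nu_2)=0$ are excluded (so $(1-a\nu_1)(1-a\nu_2)\neq0$ on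 the domain considered). Its unit normal is $\bar l=\varepsilon l$, $\varepsilon=\mathrm{sign}\,(1-a\nu_1)(1-a\nu_2)$. It is a Weingarten surface with the same function $\nu(u,v)$ and Weingarten functions $\bar f=\frac{\varepsilon f}{1-af}$, $\bar g=\frac{\varepsilon g}{1-ag}$; natural principality of $(u,v)$ on $\bar S(a)$ is meant with respect to these functions and the first fundamental form of $\bar S(a)$. *)

theory Defs
  imports "HOL-Analysis.Analysis"
begin

definition pdu :: "(real \<times> real \<Rightarrow> 'a::real_normed_vector) \<Rightarrow> real \<times> real \<Rightarrow> 'a" where
  "pdu \<phi> p = vector_derivative (\<lambda>s. \<phi> (s, snd p)) (at (fst p))"

definition pdv :: "(real \<times> real \<Rightarrow> 'a::real_normed_vector) \<Rightarrow> real \<times> real \<Rightarrow> 'a" where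
  "pdv \<phi> p = vector_derivative (\<lambda>t. \<phi> (fst p, t)) (at (snd p))"

(* C^k on an open set D: all partial derivatives up to order k exist and are continuous.
   Requiring total differentiability in the step guarantees that the values of pdu and pdv
   are genuine partial derivatives. *)
primrec Ck_on :: "nat \<Rightarrow> (real \<times> real) set \<Rightarrow> (real \<times> real \<Rightarrow> 'a::real_normed_vector) \<Rightarrow> bool" where
  "Ck_on 0 D \<phi> \<longleftrightarrow> continuous_on D \<phi>"
| "Ck_on (Suc k) D \<phi> \<longleftrightarrow>
     \<phi> differentiable_on D \<and> Ck_on k D (pdu \<phi>) \<and> Ck_on k D (pdv \<phi>)"

definition param_domain :: "(real \<times> real) set \<Rightarrow> bool" where
  "param_domain D \<longleftrightarrow> open D \<and> connected D \<and> D \<noteq> {}"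

definition unit_normal :: "(real \<times> real \<Rightarrow> real^3) \<Rightarrow> real \<times> real \<Rightarrow> real^3" where
  "unit_normal z p = sgn (cross3 (pdu z p) (pdv z p))"

definition coeff_E :: "(real \<times> real \<Rightarrow> real^3) \<Rightarrow> real \<times> real \<Rightarrow> real" where
  "coeff_E z p = pdu z p \<bullet> pdu z p"

definition coeff_F :: "(real \<times> real \<Rightarrow> real^3) \<Rightarrow> real \<times> real \<Rightarrow> real" where
  "coeff_F z p = pdu z p \<bullet> pdv z p"

definition coeff_G :: "(real \<times> real \<Rightarrow> real^3) \<Rightarrow> real \<times> real \<Rightarrow> real" where
  "coeff_G z p = pdv z p \<bullet> pdv z p"

definition coeff_L :: "(real \<times> real \<Rightarrow> real^3) \<Rightarrow> real \<times> real \<Rightarrow> real" where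
  "coeff_L z p = pdu (pdu z) p \<bullet> unit_normal z p"

definition coeff_M :: "(real \<times> real \<Rightarrow> real^3) \<Rightarrow> real \<times> real \<Rightarrow> real" where
  "coeff_M z p = pdv (pdu z) p \<bullet> unit_normal z p"

definition coeff_N :: "(real \<times> real \<Rightarrow> real^3) \<Rightarrow> real \<times> real \<Rightarrow> real" where
  "coeff_N z p = pdv (pdv z) p \<bullet> unit_normal z p"

definition curv1 :: "(real \<times> real \<Rightarrow> real^3) \<Rightarrow> real \<times> real \<Rightarrow> real" where
  "curv1 z p = coeff_L z p / coeff_E z p"

definition curv2 :: "(real \<times> real \<Rightarrow> real^3) \<Rightarrow> real \<times> real \<Rightarrow> real" where
  "curv2 z p = coeff_N z p / coeff_G z p"

(* A regular surface of class C^k in principal parameters (u,v). Under F = M = 0 the functions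
   curv1 and curv2 are the principal curvatures, so the last condition excludes umbilical points;
   its sign is the usual normalization of the orientation. *)
definition principal_surface :: "nat \<Rightarrow> (real \<times> real) set \<Rightarrow> (real \<times> real \<Rightarrow> real^3) \<Rightarrow> bool" where
  "principal_surface k D z \<longleftrightarrow>
     param_domain D \<and> Ck_on k D z \<and>
     (\<forall>p\<in>D. cross3 (pdu z p) (pdv z p) \<noteq> 0 \<and> coeff_F z p = 0 \<and> coeff_M z p = 0 \<and>
            curv1 z p - curv2 z p > 0)"

(* The interval I is taken open; this is no restriction, since grad \<nu> \<noteq> 0 on the connected open
   set D makes \<nu> ` D an open interval. *)
definition weingarten_surface ::
  "nat \<Rightarrow> (real \<times> real) set \<Rightarrow> (real \<times> real \<Rightarrow> real^3) \<Rightarrow>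
   (real \<Rightarrow> real) \<Rightarrow> (real \<Rightarrow> real) \<Rightarrow> (real \<times> real \<Rightarrow> real) \<Rightarrow> bool" where
  "weingarten_surface k D z f g \<nu> \<longleftrightarrow>
     principal_surface k D z \<and>
     (\<exists>I. is_interval I \<and> open I \<and> \<nu> ` D \<subseteq> I \<and>
        (\<forall>x\<in>I. f differentiable (at x) \<and> g differentiable (at x) \<and>
               f x - g x \<noteq> 0 \<and> deriv f x * deriv g x \<noteq> 0)) \<and>
     \<nu> differentiable_on D \<and>
     (\<forall>p\<in>D. (pdu \<nu> p, pdv \<nu> p) \<noteq> (0, 0) \<and> curv1 z p = f (\<nu> p) \<and> curv2 z p = g (\<nu> p))"

(* \<Phi> and \<Psi> are antiderivatives of f'/(f-g) and g'/(g-f) on the interval \<nu> ` D. They always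
   exist there and are unique up to additive constants, so the choice does not matter. *)
definition natural_principal_parameters ::
  "nat \<Rightarrow> (real \<times> real) set \<Rightarrow> (real \<times> real \<Rightarrow> real^3) \<Rightarrow>
   (real \<Rightarrow> real) \<Rightarrow> (real \<Rightarrow> real) \<Rightarrow> (real \<times> real \<Rightarrow> real) \<Rightarrow> bool" where
  "natural_principal_parameters k D z f g \<nu> \<longleftrightarrow>
     weingarten_surface k D z f g \<nu> \<and>
     (\<exists>\<Phi>. (\<forall>x\<in>\<nu> ` D. (\<Phi> has_real_derivative deriv f x / (f x - g x)) (at x within \<nu> ` D)) \<and>
          (\<lambda>p. sqrt (coeff_E z p) * exp (\<Phi> (\<nu> p))) constant_on D) \<and>
     (\<exists>\<Psi>. (\<forall>x\<in>\<nu> ` D. (\<Psi> has_real_derivative deriv g x / (g x - f x)) (at x within \<nu> ` D)) \<and>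
          (\<lambda>p. sqrt (coeff_G z p) * exp (\<Psi> (\<nu> p))) constant_on D)"

definition parallel_surface ::
  "real \<Rightarrow> (real \<times> real \<Rightarrow> real^3) \<Rightarrow> real \<times> real \<Rightarrow> real^3" where
  "parallel_surface a z p = z p + a *\<^sub>R unit_normal z p"

(* The sign \<epsilon> of (1 - a curv1)(1 - a curv2), written as a function of the value of \<nu>. *)
definition parallel_sign :: "real \<Rightarrow> (real \<Rightarrow> real) \<Rightarrow> (real \<Rightarrow> real) \<Rightarrow> real \<Rightarrow> real" where
  "parallel_sign a f g x = sgn ((1 - a * f x) * (1 - a * g x))"

definition parallel_f :: "real \<Rightarrow> (real \<Rightarrow> real) \<Rightarrow> (real \<Rightarrow> real) \<Rightarrow> real \<Rightarrow> real" where
  "parallel_f a f g x = parallel_sign a f g x * f x / (1 - a * f x)"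

definition parallel_g :: "real \<Rightarrow> (real \<Rightarrow> real) \<Rightarrow> (real \<Rightarrow> real) \<Rightarrow> real \<Rightarrow> real" where
  "parallel_g a f g x = parallel_sign a f g x * g x / (1 - a * g x)"

end

(* Moving along the normal by a multiplies z_u and z_v by 1 - a \<nu>\<^sub>1 and 1 - a \<nu>\<^sub>2 (Weingarten
   equations, which rely on the symmetry of second derivatives), so sqrt E is multiplied by
   |1 - a f(\<nu>)|. On the other side f'/(f - g) becomes
     f'(1 - a g) / ((f - g)(1 - a f)) = f'/(f - g) + a f'/(1 - a f),
   so the antiderivative \<Phi> becomes \<Phi> - ln |1 - a f| and the two factors cancel in
   sqrt E exp \<Phi>. The sign \<epsilon> is constant because \<nu> ` D' is an interval, and this interval is open
   because grad \<nu> never vanishes. *)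
theory Submission
  imports Defs
begin

section \<open>Partial derivatives and the classes \<open>Ck_on\<close>\<close>

text \<open>\<open>pdu\<close> and \<open>pdv\<close> rest on \<open>vector_derivative\<close>,
  which is an arbitrary value where no derivative exists. Every differentiation therefore comes with
  a differentiability proof; the classes \<open>Ck_on\<close> supply these, and the unit normal has
  to be placed in such a class. Since the normal is built from first derivatives of
  \<open>z\<close>, the parallel surface is only known to be one order less smooth than the
  original. The second fundamental form of the parallel surface is not found by differentiating the
  factors \<open>1 - a * curv1 z p\<close> and \<open>1 - a * curv2 z p\<close>. Its tangent vectors
  are orthogonal to the old normal, and differentiating this orthogonality moves the second
  derivative onto the normal, where the Weingarten equations apply. Differentiating
  \<open>parallel_f\<close> requires a whole neighbourhood in which no denominator vanishes and the
  sign is constant. The exclusion of points controls the denominators only at values taken by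
  \<open>\<nu>\<close> on \<open>D'\<close>; this is why the openness of that image matters. The
  half concerning G and \<open>g\<close> is the half concerning E and \<open>f\<close> with the two
  functions interchanged.\<close>

lemma has_vector_derivative_pdu:
  assumes "\<phi> differentiable (at p)"
  shows "((\<lambda>s. \<phi> (s, snd p)) has_vector_derivative pdu \<phi> p) (at (fst p))"
proof -
  have "(\<phi> \<circ> (\<lambda>s. (s, snd p))) differentiable (at (fst p))"
    using assms by (intro differentiable_chain_at) (auto intro!: derivative_intros)
  then show ?thesis
    by (simp add: pdu_def o_def vector_derivative_works)
qed

lemma has_vector_derivative_pdv:
  assumes "\<phi> differentiable (at p)"
  shows "((\<lambda>t. \<phi> (fst p, t)) has_vector_derivative pdv \<phi> p) (at (snd p))"
proof -
  have "(\<phi> \<circ> (\<lambda>t. (fst p, t))) differentiable (at (snd p))"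
    using assms by (intro differentiable_chain_at) (auto intro!: derivative_intros)
  then show ?thesis
    by (simp add: pdv_def o_def vector_derivative_works)
qed

text \<open>Restricting a total derivative to the coordinate lines through \<open>p\<close>
  evaluates it at the basis vectors. The sum, product and chain rules for partial derivatives are
  read off in this way from the rules for \<open>has_derivative\<close>.\<close>

lemma has_derivative_imp_pd:
  assumes "(\<phi> has_derivative \<phi>') (at p)"
  shows "pdu \<phi> p = \<phi>' (1, 0)" and "pdv \<phi> p = \<phi>' (0, 1)"
proof -
  interpret bounded_linear \<phi>' using assms by (rule has_derivative_bounded_linear)
  have p: "(\<phi> has_derivative \<phi>') (at (fst p, snd p))" using assms by simp
  have "((\<lambda>s. \<phi> (s, snd p)) has_derivative (\<lambda>h. \<phi>' (h, 0))) (at (fst p))"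
    by (rule has_derivative_compose[of "\<lambda>s. (s, snd p)" "\<lambda>h. (h, 0)" _ _ \<phi>, OF _ p])
      (auto intro!: derivative_eq_intros)
  moreover have "(\<lambda>h. \<phi>' (h, 0)) = (\<lambda>h. h *\<^sub>R \<phi>' (1, 0))"
    by (rule ext) (simp flip: scaleR)
  ultimately show "pdu \<phi> p = \<phi>' (1, 0)"
    unfolding pdu_def
    by (intro vector_derivative_at) (simp only: has_vector_derivative_def)
  have "((\<lambda>t. \<phi> (fst p, t)) has_derivative (\<lambda>h. \<phi>' (0, h))) (at (snd p))"
    by (rule has_derivative_compose[of "\<lambda>t. (fst p, t)" "\<lambda>h. (0, h)" _ _ \<phi>, OF _ p])
      (auto intro!: derivative_eq_intros)
  moreover have "(\<lambda>h. \<phi>' (0, h)) = (\<lambda>h. h *\<^sub>R \<phi>' (0, 1))"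
    by (rule ext) (simp flip: scaleR)
  ultimately show "pdv \<phi> p = \<phi>' (0, 1)"
    unfolding pdv_def
    by (intro vector_derivative_at) (simp only: has_vector_derivative_def)
qed

lemma has_derivative_pd:
  assumes "\<phi> differentiable (at p)"
  shows "(\<phi> has_derivative (\<lambda>h. fst h *\<^sub>R pdu \<phi> p + snd h *\<^sub>R pdv \<phi> p)) (at p)"
proof -
  obtain \<phi>' where d: "(\<phi> has_derivative \<phi>') (at p)"
    using assms by (auto simp: differentiable_def)
  interpret bounded_linear \<phi>' using d by (rule has_derivative_bounded_linear)
  have "\<phi>' = (\<lambda>h. fst h *\<^sub>R pdu \<phi> p + snd h *\<^sub>R pdv \<phi> p)"
    unfolding has_derivative_imp_pd[OF d] by (rule ext) (simp flip: scaleR add)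
  then show ?thesis using d by simp
qed

text \<open>Relations on the surface hold only on \<open>D\<close>. An open box around
  \<open>p\<close> inside \<open>D\<close> turns them into relations along both coordinate lines
  near \<open>p\<close>, so that they can be differentiated.\<close>

lemma pd_cong:
  assumes "open D" "p \<in> D" "\<And>q. q \<in> D \<Longrightarrow> \<phi> q = \<psi> q"
  shows "pdu \<phi> p = pdu \<psi> p" and "pdv \<phi> p = pdv \<psi> p"
proof -
  obtain A B where AB: "open A" "open B" "fst p \<in> A" "snd p \<in> B" "A \<times> B \<subseteq> D"
    using open_prod_elim[OF assms(1,2)] by (metis mem_Times_iff)
  have "\<forall>\<^sub>F s in nhds (fst p). \<phi> (s, snd p) = \<psi> (s, snd p)"
    unfolding eventually_nhds using AB assms(3) by (intro exI[of _ A]) auto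
  then show "pdu \<phi> p = pdu \<psi> p"
    unfolding pdu_def by (intro vector_derivative_cong_eq) auto
  have "\<forall>\<^sub>F t in nhds (snd p). \<phi> (fst p, t) = \<psi> (fst p, t)"
    unfolding eventually_nhds using AB assms(3) by (intro exI[of _ B]) auto
  then show "pdv \<phi> p = pdv \<psi> p"
    unfolding pdv_def by (intro vector_derivative_cong_eq) auto
qed

lemma pd_add:
  assumes "\<phi> differentiable (at p)" "\<psi> differentiable (at p)"
  shows "pdu (\<lambda>q. \<phi> q + \<psi> q) p = pdu \<phi> p + pdu \<psi> p"
    and "pdv (\<lambda>q. \<phi> q + \<psi> q) p = pdv \<phi> p + pdv \<psi> p"
  using has_derivative_imp_pd[OF has_derivative_add[OF assms[THEN has_derivative_pd]]]
  by simp_all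

context bounded_bilinear
begin

text \<open>Stated for an arbitrary bounded bilinear map, since inner products and multiplication by
  scalar functions both have to be differentiated.\<close>

lemma pd_prod:
  fixes \<phi> :: "real \<times> real \<Rightarrow> 'a" and \<psi> :: "real \<times> real \<Rightarrow> 'b"
  assumes "\<phi> differentiable (at p)" "\<psi> differentiable (at p)"
  shows "pdu (\<lambda>q. prod (\<phi> q) (\<psi> q)) p = prod (\<phi> p) (pdu \<psi> p) + prod (pdu \<phi> p) (\<psi> p)"
    and "pdv (\<lambda>q. prod (\<phi> q) (\<psi> q)) p = prod (\<phi> p) (pdv \<psi> p) + prod (pdv \<phi> p) (\<psi> p)"
  using has_derivative_imp_pd[OF FDERIV[OF assms[THEN has_derivative_pd]]]
  by simp_all

end

lemma pd_const: "pdu (\<lambda>q. c) p = 0" "pdv (\<lambda>q. c) p = 0"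
  by (rule has_derivative_imp_pd[OF has_derivative_const])+

section \<open>Closure properties of the classes \<open>Ck_on\<close>\<close>

lemma Ck_on_cong:
  assumes "open D" "\<And>q. q \<in> D \<Longrightarrow> \<phi> q = \<psi> q" "Ck_on k D \<phi>"
  shows "Ck_on k D \<psi>"
  using assms(2,3)
proof (induction k arbitrary: \<phi> \<psi>)
  case 0
  then show ?case by (simp cong: continuous_on_cong)
next
  case (Suc k)
  have "\<psi> differentiable_on D"
    using Suc.prems by (auto simp: differentiable_on_def intro: differentiable_transform_within[OF _ zero_less_one])
  moreover have "Ck_on k D (pdu \<psi>)"
    by (rule Suc.IH[of "pdu \<phi>"]) (use Suc.prems pd_cong[OF assms(1) _ Suc.prems(1)] in auto)
  moreover have "Ck_on k D (pdv \<psi>)"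
    by (rule Suc.IH[of "pdv \<phi>"]) (use Suc.prems pd_cong[OF assms(1) _ Suc.prems(1)] in auto)
  ultimately show ?case by simp
qed

lemma Ck_on_Suc_imp: "Ck_on (Suc k) D \<phi> \<Longrightarrow> Ck_on k D \<phi>"
proof (induction k arbitrary: \<phi>)
  case 0
  then show ?case by (simp add: differentiable_imp_continuous_on)
next
  case (Suc k)
  have d: "\<phi> differentiable_on D" and p: "Ck_on (Suc k) D (pdu \<phi>)" "Ck_on (Suc k) D (pdv \<phi>)"
    using Suc.prems unfolding Ck_on.simps(2)[of "Suc k"] by blast+
  show ?case using d p[THEN Suc.IH] by simp
qed

lemma Ck_on_mono:
  assumes "Ck_on m D \<phi>" "k \<le> m"
  shows "Ck_on k D \<phi>"
  using assms(2,1)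
proof (induction rule: dec_induct)
  case (step n)
  show ?case by (rule step.IH) (rule Ck_on_Suc_imp[OF step.prems])
qed

lemma Ck_on_subset:
  assumes "Ck_on k D \<phi>" "D' \<subseteq> D"
  shows "Ck_on k D' \<phi>"
  using assms(1)
proof (induction k arbitrary: \<phi>)
  case 0
  then show ?case using assms(2) by (simp add: continuous_on_subset)
next
  case (Suc k)
  then show ?case using assms(2) differentiable_on_subset by auto
qed

lemma Ck_on_Suc_differentiable:
  assumes "Ck_on (Suc k) D \<phi>" "open D" "p \<in> D"
  shows "\<phi> differentiable (at p)"
  using assms by (simp add: differentiable_on_eq_differentiable_at)

lemma Ck_on_const: "Ck_on k D (\<lambda>q. c)"
proof (induction k arbitrary: c)
  case (Suc k)
  have "pdu (\<lambda>q. c) = (\<lambda>q. 0)" "pdv (\<lambda>q. c) = (\<lambda>q. 0)" by (auto simp: pd_const)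
  then show ?case using Suc by simp
qed simp

lemma Ck_on_add:
  assumes "open D" "Ck_on k D \<phi>" "Ck_on k D \<psi>"
  shows "Ck_on k D (\<lambda>q. \<phi> q + \<psi> q)"
  using assms(2,3)
proof (induction k arbitrary: \<phi> \<psi>)
  case 0
  then show ?case by (simp add: continuous_on_add)
next
  case (Suc k)
  note d = Suc.prems[THEN Ck_on_Suc_differentiable, OF assms(1)]
  \<comment> \<open>The sum rule is available only at points of \<open>D\<close>, where both
    summands are differentiable. The two sides are thus compared on \<open>D\<close> alone, through
    \<open>Ck_on_cong\<close>.\<close>
  have "Ck_on k D (pdu (\<lambda>q. \<phi> q + \<psi> q))"
    by (rule Ck_on_cong[OF assms(1) pd_add(1)[OF d, symmetric] Suc.IH]) (use Suc.prems in auto)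
  moreover have "Ck_on k D (pdv (\<lambda>q. \<phi> q + \<psi> q))"
    by (rule Ck_on_cong[OF assms(1) pd_add(2)[OF d, symmetric] Suc.IH]) (use Suc.prems in auto)
  ultimately show ?case using Suc.prems by simp
qed

lemma (in bounded_bilinear) Ck_on_prod:
  fixes \<phi> :: "real \<times> real \<Rightarrow> 'a" and \<psi> :: "real \<times> real \<Rightarrow> 'b"
  assumes "open D" "Ck_on k D \<phi>" "Ck_on k D \<psi>"
  shows "Ck_on k D (\<lambda>q. prod (\<phi> q) (\<psi> q))"
  using assms(2,3)
proof (induction k arbitrary: \<phi> \<psi>)
  case 0
  then show ?case by (simp add: continuous_on)
next
  case (Suc k)
  note d = Suc.prems[THEN Ck_on_Suc_differentiable, OF assms(1)]
  \<comment> \<open>Each term of the product rule has one undifferentiated factor, still of class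
    \<open>Suc k\<close>; it is lowered to class \<open>k\<close> to fit the induction
    hypothesis.\<close>
  note low = Suc.prems[THEN Ck_on_Suc_imp]
  have "Ck_on k D (pdu (\<lambda>q. prod (\<phi> q) (\<psi> q)))"
    by (rule Ck_on_cong[OF assms(1) pd_prod(1)[OF d, symmetric] Ck_on_add[OF assms(1) Suc.IH Suc.IH]])
      (use Suc.prems low in auto)
  moreover have "Ck_on k D (pdv (\<lambda>q. prod (\<phi> q) (\<psi> q)))"
    by (rule Ck_on_cong[OF assms(1) pd_prod(2)[OF d, symmetric] Ck_on_add[OF assms(1) Suc.IH Suc.IH]])
      (use Suc.prems low in auto)
  moreover have "(\<lambda>q. prod (\<phi> q) (\<psi> q)) differentiable_on D"
    using FDERIV[OF d[THEN has_derivative_pd]] assms(1)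
    by (auto simp: differentiable_on_eq_differentiable_at differentiable_def)
  ultimately show ?case by simp
qed

text \<open>The induction closes because the derivative of \<open>r = inverse (sqrt \<phi>)\<close>
  is a polynomial in \<open>r\<close> itself times a derivative of \<open>\<phi>\<close>: it is
  \<open>- 1/2 * r^3\<close> times \<open>pdu \<phi>\<close> or \<open>pdv \<phi>\<close>.
  Normalizing a nonvanishing vector field is then a matter of products.\<close>

lemma Ck_on_inverse_sqrt:
  fixes \<phi> :: "real \<times> real \<Rightarrow> real"
  assumes "open D" "Ck_on k D \<phi>" "\<And>q. q \<in> D \<Longrightarrow> \<phi> q > 0"
  shows "Ck_on k D (\<lambda>q. inverse (sqrt (\<phi> q)))"
  using assms(2)
proof (induction k)
  case 0
  then show ?case using assms(3) by (force intro!: continuous_intros)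
next
  case (Suc k)
  define r where "r = (\<lambda>q. inverse (sqrt (\<phi> q)))"
  define w where "w = (\<lambda>q. - 1/2 * (r q * (r q * r q)))"
  note mult = bounded_bilinear.Ck_on_prod[OF bounded_bilinear_mult assms(1)]
  have "Ck_on k D r" using Suc.IH Suc.prems Ck_on_Suc_imp unfolding r_def by blast
  then have w: "Ck_on k D w" unfolding w_def by (intro mult Ck_on_const \<open>Ck_on k D r\<close>)
  have der: "(r has_derivative (\<lambda>h. w q * (fst h * pdu \<phi> q + snd h * pdv \<phi> q))) (at q)"
    if "q \<in> D" for q
  proof -
    have "((\<lambda>x. inverse (sqrt x)) has_real_derivative w q) (at (\<phi> q))"
      using assms(3)[OF that] unfolding w_def r_def
      by (auto intro!: derivative_eq_intros simp: field_simps)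
    from has_derivative_compose[OF has_derivative_pd[OF Ck_on_Suc_differentiable[OF Suc.prems assms(1) that]]
        this[unfolded has_field_derivative_def]]
    show ?thesis by (simp add: r_def)
  qed
  have "Ck_on k D (pdu r)"
    by (rule Ck_on_cong[OF assms(1) _ mult[OF w, of "pdu \<phi>"]])
      (use Suc.prems has_derivative_imp_pd[OF der] in auto)
  moreover have "Ck_on k D (pdv r)"
    by (rule Ck_on_cong[OF assms(1) _ mult[OF w, of "pdv \<phi>"]])
      (use Suc.prems has_derivative_imp_pd[OF der] in auto)
  moreover have "r differentiable_on D"
    using der assms(1) by (auto simp: differentiable_on_eq_differentiable_at differentiable_def)
  ultimately show ?case by (simp add: r_def)
qed

lemma Ck_on_sgn:
  fixes \<phi> :: "real \<times> real \<Rightarrow> 'a::real_inner"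
  assumes "open D" "Ck_on k D \<phi>" "\<And>q. q \<in> D \<Longrightarrow> \<phi> q \<noteq> 0"
  shows "Ck_on k D (\<lambda>q. sgn (\<phi> q))"
proof -
  have "Ck_on k D (\<lambda>q. inverse (sqrt (\<phi> q \<bullet> \<phi> q)))"
    using assms bounded_bilinear.Ck_on_prod[OF bounded_bilinear_inner assms(1,2,2)]
    by (intro Ck_on_inverse_sqrt) auto
  from bounded_bilinear.Ck_on_prod[OF bounded_bilinear_scaleR assms(1) this assms(2)]
  show ?thesis by (simp add: sgn_div_norm norm_eq_sqrt_inner)
qed

section \<open>Symmetry of second derivatives\<close>

text \<open>The mean value theorem is used twice, in \<open>s\<close> for the increment
  \<open>F s (v+h) - F s v\<close> and then in \<open>t\<close> for \<open>F1\<close>. With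
  \<open>F\<close> curried, the lemma also applies after exchanging the variables, which leaves the
  mixed difference unchanged.\<close>

lemma mixed_difference_mvt:
  fixes F F1 F12 :: "real \<Rightarrow> real \<Rightarrow> real"
  assumes "h > 0"
    and d1: "\<And>s t. s \<in> {u..u+h} \<Longrightarrow> t \<in> {v..v+h} \<Longrightarrow> ((\<lambda>s. F s t) has_real_derivative F1 s t) (at s)"
    and d2: "\<And>s t. s \<in> {u..u+h} \<Longrightarrow> t \<in> {v..v+h} \<Longrightarrow> ((\<lambda>t. F1 s t) has_real_derivative F12 s t) (at t)"
  obtains \<xi> \<eta> where "\<xi> \<in> {u..u+h}" "\<eta> \<in> {v..v+h}"
    "F (u+h) (v+h) - F (u+h) v - F u (v+h) + F u v = h * h * F12 \<xi> \<eta>"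
proof -
  have "\<exists>\<xi>>u. \<xi> < u+h \<and> (F (u+h) (v+h) - F (u+h) v) - (F u (v+h) - F u v)
          = (u+h-u) * (F1 \<xi> (v+h) - F1 \<xi> v)"
    using \<open>h > 0\<close> by (intro MVT2 DERIV_diff d1) auto
  then obtain \<xi> where \<xi>: "u < \<xi>" "\<xi> < u+h"
    "(F (u+h) (v+h) - F (u+h) v) - (F u (v+h) - F u v) = (u+h-u) * (F1 \<xi> (v+h) - F1 \<xi> v)"
    by blast
  have "\<exists>\<eta>>v. \<eta> < v+h \<and> F1 \<xi> (v+h) - F1 \<xi> v = (v+h-v) * F12 \<xi> \<eta>"
    using \<open>h > 0\<close> \<xi>(1,2) by (intro MVT2 d2) auto
  then obtain \<eta> where \<eta>: "v < \<eta>" "\<eta> < v+h" "F1 \<xi> (v+h) - F1 \<xi> v = (v+h-v) * F12 \<xi> \<eta>"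
    by blast
  have "F (u+h) (v+h) - F (u+h) v - F u (v+h) + F u v = h * h * F12 \<xi> \<eta>"
    using \<xi>(3) unfolding \<eta>(3) by (simp add: algebra_simps)
  with \<xi>(1,2) \<eta>(1,2) show thesis by (intro that[of \<xi> \<eta>]) auto
qed

text \<open>If the two mixed derivatives \<open>A\<close> and \<open>B\<close> differed at
  \<open>p\<close>, continuity would keep each of them, near \<open>p\<close>, within less than half
  their distance of its value at \<open>p\<close>. Yet the mixed difference over a small square is
  \<open>h * h\<close> times a value of \<open>A\<close> and also \<open>h * h\<close> times a value
  of \<open>B\<close>, so some value is common to both.\<close>

lemma pd_commute_real:
  fixes \<phi> :: "real \<times> real \<Rightarrow> real"
  assumes "open D" "p \<in> D" "Ck_on 2 D \<phi>"
  shows "pdv (pdu \<phi>) p = pdu (pdv \<phi>) p"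
proof (rule ccontr)
  define A where "A = pdv (pdu \<phi>)"
  define B where "B = pdu (pdv \<phi>)"
  assume "\<not> ?thesis"
  then have e: "dist (A p) (B p) / 2 > 0" (is "?e > 0") by (simp add: A_def B_def)
  have C: "\<phi> differentiable_on D" "pdu \<phi> differentiable_on D" "pdv \<phi> differentiable_on D"
    "continuous_on D A" "continuous_on D B"
    using assms(3) by (auto simp: numeral_2_eq_2 A_def B_def)
  have "\<forall>\<^sub>F q in nhds p. q \<in> D \<and> dist (A q) (A p) < ?e \<and> dist (B q) (B p) < ?e"
    using C(4,5) assms(1,2) e
    by (intro eventually_conj eventually_nhds_in_open tendstoD)
      (auto simp: continuous_on_eq_continuous_at isCont_def tendsto_at_iff_tendsto_nhds)
  then obtain d where d: "d > 0"
    "\<And>q. dist q p < d \<Longrightarrow> q \<in> D \<and> dist (A q) (A p) < ?e \<and> dist (B q) (B p) < ?e"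
    by (auto simp: eventually_nhds_metric)
  \<comment> \<open>A point of the square with corner \<open>p\<close> and side \<open>h\<close> is
    at distance at most \<open>2 * h\<close> from \<open>p\<close>, which is below
    \<open>d\<close>.\<close>
  define h where "h = d / 3"
  obtain u v where p: "p = (u, v)" by (cases p)
  have "h > 0" using d by (simp add: h_def)
  have near: "dist (s, t) p < d" if "s \<in> {u..u+h}" "t \<in> {v..v+h}" for s t
  proof -
    have "dist (s, t) p \<le> dist s u + dist t v"
      unfolding p dist_Pair_Pair by (rule sqrt_sum_squares_le_sum) auto
    also have "\<dots> < d" using that d by (auto simp: dist_real_def h_def)
    finally show ?thesis .
  qed
  have inD: "(s, t) \<in> D" if "s \<in> {u..u+h}" "t \<in> {v..v+h}" for s t
    using near that d by blast
  note at = differentiable_on_eq_differentiable_at[OF assms(1), THEN iffD1, rule_format]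
  have du: "((\<lambda>s. \<psi> (s, t)) has_real_derivative pdu \<psi> (s, t)) (at s)"
    and dv: "((\<lambda>t. \<psi> (s, t)) has_real_derivative pdv \<psi> (s, t)) (at t)"
    if "\<psi> differentiable_on D" "(s, t) \<in> D" for \<psi> :: "real \<times> real \<Rightarrow> real" and s t
    using has_vector_derivative_pdu[OF at[OF that]] has_vector_derivative_pdv[OF at[OF that]]
    by (simp_all add: has_real_derivative_iff_has_vector_derivative)
  obtain s t where st: "s \<in> {u..u+h}" "t \<in> {v..v+h}"
    "\<phi> (u+h, v+h) - \<phi> (u+h, v) - \<phi> (u, v+h) + \<phi> (u, v) = h * h * A (s, t)"
    by (rule mixed_difference_mvt[OF \<open>h > 0\<close>, of u v "\<lambda>s t. \<phi> (s, t)" "\<lambda>s t. pdu \<phi> (s, t)" "\<lambda>s t. A (s, t)"])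
      (auto simp: A_def intro!: du dv C inD)
  obtain t' s' where st': "t' \<in> {v..v+h}" "s' \<in> {u..u+h}"
    "\<phi> (u+h, v+h) - \<phi> (u, v+h) - \<phi> (u+h, v) + \<phi> (u, v) = h * h * B (s', t')"
    by (rule mixed_difference_mvt[OF \<open>h > 0\<close>, of v u "\<lambda>t s. \<phi> (s, t)" "\<lambda>t s. pdv \<phi> (s, t)" "\<lambda>t s. B (s, t)"])
      (auto simp: B_def intro!: du dv C inD)
  have "h * h * A (s, t) = h * h * B (s', t')" using st(3) st'(3) by linarith
  then have "A (s, t) = B (s', t')" using \<open>h > 0\<close> by simp
  moreover have "dist (A (s, t)) (A p) < ?e" using d near st by blast
  moreover have "dist (B (s', t')) (B p) < ?e" using d near st' by blast
  ultimately have "dist (A p) (B p) < dist (A p) (B p)"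
    using dist_triangle_half_r[of "B (s', t')" "A p" "dist (A p) (B p)" "B p"] by simp
  then show False by simp
qed

lemma pd_inner_const:
  assumes "\<phi> differentiable (at p)"
  shows "pdu (\<lambda>q. \<phi> q \<bullet> w) p = pdu \<phi> p \<bullet> w" and "pdv (\<lambda>q. \<phi> q \<bullet> w) p = pdv \<phi> p \<bullet> w"
  using bounded_bilinear.pd_prod[OF bounded_bilinear_inner assms, of "\<lambda>q. w"]
  by (simp_all add: pd_const)

text \<open>Pairing with a fixed vector \<open>w\<close> reduces the claim to real functions.
  Choosing \<open>w\<close> as the difference of the two mixed derivatives yields
  \<open>w \<bullet> w = 0\<close>.\<close>

lemma pd_commute:
  fixes \<phi> :: "real \<times> real \<Rightarrow> 'a::real_inner"
  assumes "open D" "p \<in> D" "Ck_on 2 D \<phi>"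
  shows "pdv (pdu \<phi>) p = pdu (pdv \<phi>) p"
proof -
  define w where "w = pdv (pdu \<phi>) p - pdu (pdv \<phi>) p"
  have C: "\<phi> differentiable_on D" "pdu \<phi> differentiable_on D" "pdv \<phi> differentiable_on D"
    using assms(3) by (auto simp: numeral_2_eq_2)
  note at = differentiable_on_eq_differentiable_at[OF assms(1), THEN iffD1, rule_format]
  have "pdv (pdu (\<lambda>q. \<phi> q \<bullet> w)) p = pdv (pdu \<phi>) p \<bullet> w"
    using pd_cong(2)[OF assms(1,2) pd_inner_const(1)[OF at[OF C(1)]]]
      pd_inner_const(2)[OF at[OF C(2) assms(2)]] by simp
  moreover have "pdu (pdv (\<lambda>q. \<phi> q \<bullet> w)) p = pdu (pdv \<phi>) p \<bullet> w"
    using pd_cong(1)[OF assms(1,2) pd_inner_const(2)[OF at[OF C(1)]]]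
      pd_inner_const(1)[OF at[OF C(3) assms(2)]] by simp
  moreover have "pdv (pdu (\<lambda>q. \<phi> q \<bullet> w)) p = pdu (pdv (\<lambda>q. \<phi> q \<bullet> w)) p"
    by (intro pd_commute_real[OF assms(1,2)]
        bounded_bilinear.Ck_on_prod[OF bounded_bilinear_inner] assms Ck_on_const)
  ultimately have "w \<bullet> w = 0" by (simp add: w_def inner_diff_left)
  then show ?thesis by (simp add: w_def)
qed

section \<open>The Weingarten equations\<close>

text \<open>Lagrange's identity expands the cross product of \<open>w\<close> with
  \<open>cross3 x y\<close> in \<open>x\<close> and \<open>y\<close>, with coefficients
  \<open>w \<bullet> y\<close> and \<open>w \<bullet> x\<close> up to sign, so it vanishes. A vector
  both parallel and orthogonal to a nonzero vector is 0.\<close>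

lemma orthogonal_frame_eq_0:
  fixes w x y :: "real^3"
  assumes "cross3 x y \<noteq> 0" "w \<bullet> x = 0" "w \<bullet> y = 0" "w \<bullet> cross3 x y = 0"
  shows "w = 0"
proof -
  have "cross3 w (cross3 x y) = 0" using assms by (simp add: Lagrange)
  then show ?thesis
    using assms norm_and_cross_eq_0 by metis
qed

text \<open>A derivative changes sides, with a minus sign, in an inner product that is constant on
  \<open>D\<close>. The constant is 1 for the normal with itself and 0 for a tangent vector with the
  normal.\<close>

lemma pd_inner_eq_0:
  fixes \<phi> \<psi> :: "real \<times> real \<Rightarrow> 'a::real_inner"
  assumes "open D" "p \<in> D" "\<And>q. q \<in> D \<Longrightarrow> \<phi> q \<bullet> \<psi> q = c"
    and "\<phi> differentiable (at p)" "\<psi> differentiable (at p)"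
  shows "pdu \<phi> p \<bullet> \<psi> p = - (\<phi> p \<bullet> pdu \<psi> p)" and "pdv \<phi> p \<bullet> \<psi> p = - (\<phi> p \<bullet> pdv \<psi> p)"
  using pd_cong[OF assms(1-3)] bounded_bilinear.pd_prod[OF bounded_bilinear_inner assms(4,5)]
  by (simp_all add: pd_const)

lemma unit_normal_orthogonal:
  "pdu z p \<bullet> unit_normal z p = 0" "pdv z p \<bullet> unit_normal z p = 0"
  by (simp_all add: unit_normal_def sgn_div_norm dot_cross_self)

context
  fixes k :: nat and D :: "(real \<times> real) set" and z :: "real \<times> real \<Rightarrow> real^3"
  assumes S: "principal_surface (Suc k) D z" and k: "k \<ge> 1"
begin

lemma principal_surface_open: "open D"
  using S by (simp add: principal_surface_def param_domain_def)

lemma principal_surface_cross: "p \<in> D \<Longrightarrow> cross3 (pdu z p) (pdv z p) \<noteq> 0"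
  using S by (simp add: principal_surface_def)

lemma coeff_pos:
  assumes "p \<in> D"
  shows "coeff_E z p > 0" and "coeff_G z p > 0"
  using principal_surface_cross[OF assms] by (auto simp: coeff_E_def coeff_G_def)

text \<open>One order is lost here: the cross product involves first derivatives of
  \<open>z\<close>, which are of class \<open>k\<close> for a surface of class
  \<open>Suc k\<close>.\<close>

lemma Ck_on_unit_normal: "Ck_on k D (unit_normal z)"
proof -
  interpret bounded_bilinear cross3
    by (simp add: bilinear_conv_bounded_bilinear[symmetric] bilinear_cross)
  have "Ck_on k D (\<lambda>q. sgn (cross3 (pdu z q) (pdv z q)))"
    using S principal_surface_cross
    by (intro Ck_on_sgn Ck_on_prod principal_surface_open) (auto simp: principal_surface_def)
  then show ?thesis by (rule Ck_on_cong[OF principal_surface_open, rotated]) (simp add: unit_normal_def)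
qed

lemma differentiable_at_frame:
  assumes "p \<in> D"
  shows "z differentiable (at p)" "pdu z differentiable (at p)" "pdv z differentiable (at p)"
    "unit_normal z differentiable (at p)"
proof -
  have "Ck_on (Suc (Suc 0)) D z"
    using S k by (auto simp: principal_surface_def intro: Ck_on_mono simp del: Ck_on.simps)
  moreover have "Ck_on (Suc 0) D (unit_normal z)"
    using Ck_on_unit_normal k by (auto intro: Ck_on_mono simp del: Ck_on.simps)
  ultimately show "z differentiable (at p)" "pdu z differentiable (at p)" "pdv z differentiable (at p)"
    "unit_normal z differentiable (at p)"
    using assms by (auto simp: differentiable_on_eq_differentiable_at[OF principal_surface_open])
qed

lemma weingarten_equations:
  assumes "p \<in> D"
  shows "pdu (unit_normal z) p = - curv1 z p *\<^sub>R pdu z p"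
    and "pdv (unit_normal z) p = - curv2 z p *\<^sub>R pdv z p"
proof -
  note d = differentiable_at_frame[OF assms]
  note cross = principal_surface_cross[OF assms]
  note uni = pd_inner_eq_0[OF principal_surface_open assms]
  have FM: "pdu z p \<bullet> pdv z p = 0" "pdv (pdu z) p \<bullet> unit_normal z p = 0"
    using S assms by (auto simp: principal_surface_def coeff_F_def coeff_M_def)
  have "Ck_on 2 D z"
    using S k by (auto simp: principal_surface_def intro: Ck_on_mono simp del: Ck_on.simps)
  \<comment> \<open>\<open>coeff_M\<close> differentiates in \<open>u\<close> and then in
    \<open>v\<close>, whereas the component of the \<open>u\<close>-derivative of the normal along
    \<open>pdv z p\<close> produces the opposite order.\<close>
  then have M': "pdu (pdv z) p \<bullet> unit_normal z p = 0"
    using pd_commute[OF principal_surface_open assms, of z] FM by simp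
  \<comment> \<open>The third orthogonality required by \<open>orthogonal_frame_eq_0\<close> is to
    the cross product; this rewrites it as orthogonality to the unit normal.\<close>
  have normal: "cross3 (pdu z p) (pdv z p) = norm (cross3 (pdu z p) (pdv z p)) *\<^sub>R unit_normal z p"
    using cross by (simp add: unit_normal_def sgn_div_norm)
  have "unit_normal z q \<bullet> unit_normal z q = 1" if "q \<in> D" for q
    using principal_surface_cross[OF that]
    by (simp add: unit_normal_def norm_sgn flip: power2_norm_eq_inner)
  from uni[OF this d(4,4)]
  have l: "pdu (unit_normal z) p \<bullet> unit_normal z p = 0" "pdv (unit_normal z) p \<bullet> unit_normal z p = 0"
    by (simp_all add: inner_commute)
  have uu: "pdu (unit_normal z) p \<bullet> pdu z p = - coeff_L z p"
    using uni(1)[OF unit_normal_orthogonal(1) d(2,4)] by (simp add: coeff_L_def inner_commute)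
  have uv: "pdu (unit_normal z) p \<bullet> pdv z p = 0"
    using uni(1)[OF unit_normal_orthogonal(2) d(3,4)] M' by (simp add: inner_commute)
  have vu: "pdv (unit_normal z) p \<bullet> pdu z p = 0"
    using uni(2)[OF unit_normal_orthogonal(1) d(2,4)] FM by (simp add: inner_commute)
  have vv: "pdv (unit_normal z) p \<bullet> pdv z p = - coeff_N z p"
    using uni(2)[OF unit_normal_orthogonal(2) d(3,4)] by (simp add: coeff_N_def inner_commute)
  have EG: "coeff_L z p = curv1 z p * (pdu z p \<bullet> pdu z p)" "coeff_N z p = curv2 z p * (pdv z p \<bullet> pdv z p)"
    using coeff_pos[OF assms] by (auto simp: curv1_def curv2_def coeff_E_def coeff_G_def)
  have "pdu (unit_normal z) p + curv1 z p *\<^sub>R pdu z p = 0"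
    by (rule orthogonal_frame_eq_0[OF cross]; (subst normal)?)
      (simp_all add: inner_add_left uu uv EG FM l unit_normal_orthogonal)
  then show "pdu (unit_normal z) p = - curv1 z p *\<^sub>R pdu z p"
    by (simp add: eq_neg_iff_add_eq_0)
  have "pdv (unit_normal z) p + curv2 z p *\<^sub>R pdv z p = 0"
    by (rule orthogonal_frame_eq_0[OF cross]; (subst normal)?)
      (simp_all add: inner_add_left vu vv EG FM l unit_normal_orthogonal inner_commute[of "pdv z p" "pdu z p"])
  then show "pdv (unit_normal z) p = - curv2 z p *\<^sub>R pdv z p"
    by (simp add: eq_neg_iff_add_eq_0)
qed

section \<open>Fundamental forms of a parallel surface\<close>

lemma Ck_on_parallel_surface: "Ck_on k D (parallel_surface a z)"
proof -
  have "Ck_on k D (\<lambda>q. z q + a *\<^sub>R unit_normal z q)"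
    using S Ck_on_Suc_imp[of k D z]
    by (intro Ck_on_add principal_surface_open Ck_on_unit_normal Ck_on_const
        bounded_bilinear.Ck_on_prod[OF bounded_bilinear_scaleR])
      (auto simp: principal_surface_def)
  then show ?thesis by (simp add: parallel_surface_def[abs_def])
qed

lemma pd_parallel_surface:
  assumes "p \<in> D"
  shows "pdu (parallel_surface a z) p = (1 - a * curv1 z p) *\<^sub>R pdu z p"
    and "pdv (parallel_surface a z) p = (1 - a * curv2 z p) *\<^sub>R pdv z p"
proof -
  note d = differentiable_at_frame[OF assms]
  have "(\<lambda>q. a *\<^sub>R unit_normal z q) differentiable (at p)" using d by simp
  note add = pd_add[OF d(1) this]
  have sc: "pdu (\<lambda>q. a *\<^sub>R unit_normal z q) p = a *\<^sub>R pdu (unit_normal z) p"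
    "pdv (\<lambda>q. a *\<^sub>R unit_normal z q) p = a *\<^sub>R pdv (unit_normal z) p"
    using bounded_bilinear.pd_prod[OF bounded_bilinear_scaleR _ d(4), of "\<lambda>q. a"]
    by (simp_all add: pd_const)
  show "pdu (parallel_surface a z) p = (1 - a * curv1 z p) *\<^sub>R pdu z p"
    "pdv (parallel_surface a z) p = (1 - a * curv2 z p) *\<^sub>R pdv z p"
    using add by (simp_all add: parallel_surface_def[abs_def] sc weingarten_equations[OF assms] algebra_simps)
qed

lemma parallel_surface_forms:
  fixes a :: real
  assumes p: "p \<in> D" and k2: "k \<ge> 2"
  defines "\<epsilon> \<equiv> sgn ((1 - a * curv1 z p) * (1 - a * curv2 z p))"
  shows "coeff_E (parallel_surface a z) p = (1 - a * curv1 z p)\<^sup>2 * coeff_E z p"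
    and "coeff_F (parallel_surface a z) p = 0"
    and "coeff_G (parallel_surface a z) p = (1 - a * curv2 z p)\<^sup>2 * coeff_G z p"
    and "unit_normal (parallel_surface a z) p = \<epsilon> *\<^sub>R unit_normal z p"
    and "coeff_L (parallel_surface a z) p = \<epsilon> * curv1 z p * (1 - a * curv1 z p) * coeff_E z p"
    and "coeff_M (parallel_surface a z) p = 0"
    and "coeff_N (parallel_surface a z) p = \<epsilon> * curv2 z p * (1 - a * curv2 z p) * coeff_G z p"
proof -
  let ?P = "parallel_surface a z"
  note pd = pd_parallel_surface[of _ a]
  have F: "pdu z p \<bullet> pdv z p = 0"
    using S p by (auto simp: principal_surface_def coeff_F_def)
  show "coeff_E ?P p = (1 - a * curv1 z p)\<^sup>2 * coeff_E z p"
    "coeff_F ?P p = 0" "coeff_G ?P p = (1 - a * curv2 z p)\<^sup>2 * coeff_G z p"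
    by (simp_all add: coeff_E_def coeff_F_def coeff_G_def pd[OF p] F power2_eq_square)
  have "cross3 (pdu ?P p) (pdv ?P p)
      = ((1 - a * curv1 z p) * (1 - a * curv2 z p)) *\<^sub>R cross3 (pdu z p) (pdv z p)"
    by (simp add: pd[OF p] cross_mult_left cross_mult_right)
  \<comment> \<open>Because \<open>sgn 0 = 0\<close>, both sides are 0 where the product of the two
    factors vanishes, so the formula covers all of \<open>D\<close>.\<close>
  then show n: "unit_normal ?P p = \<epsilon> *\<^sub>R unit_normal z p"
    unfolding unit_normal_def \<epsilon>_def by (simp only: sgn_scaleR)
  have "Ck_on (Suc (Suc 0)) D ?P"
    using Ck_on_parallel_surface[of a] k2 by (auto intro: Ck_on_mono simp del: Ck_on.simps)
  then have d: "pdu ?P differentiable (at p)" "pdv ?P differentiable (at p)"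
    using p by (auto simp: differentiable_on_eq_differentiable_at[OF principal_surface_open])
  note dl = differentiable_at_frame(4)[OF p]
  have "pdu ?P q \<bullet> unit_normal z q = 0" "pdv ?P q \<bullet> unit_normal z q = 0" if "q \<in> D" for q
    by (simp_all add: pd[OF that] unit_normal_orthogonal)
  \<comment> \<open>The tangent vectors of the parallel surface are multiples of those of the
    original and hence orthogonal to its normal. Differentiating this replaces second derivatives of
    the parallel surface by first derivatives of the normal.\<close>
  note s = pd_inner_eq_0[OF principal_surface_open p this(1) d(1) dl]
    pd_inner_eq_0[OF principal_surface_open p this(2) d(2) dl]
  show "coeff_L ?P p = \<epsilon> * curv1 z p * (1 - a * curv1 z p) * coeff_E z p"
    "coeff_M ?P p = 0"
    "coeff_N ?P p = \<epsilon> * curv2 z p * (1 - a * curv2 z p) * coeff_G z p"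
    by (simp_all add: coeff_L_def coeff_M_def coeff_N_def coeff_E_def coeff_G_def n s
        weingarten_equations[OF p] pd[OF p] F)
qed

text \<open>This is the pointwise curvature formula, before the curvatures are known as functions of
  \<open>\<nu>\<close>. It reuses \<open>parallel_f\<close> and \<open>parallel_g\<close> with
  constant functions, so the argument \<open>x\<close> is a dummy.\<close>

lemma curv_parallel_surface:
  assumes "p \<in> D" "k \<ge> 2" "(1 - a * curv1 z p) * (1 - a * curv2 z p) \<noteq> 0"
  shows "curv1 (parallel_surface a z) p = parallel_f a (\<lambda>_. curv1 z p) (\<lambda>_. curv2 z p) x"
    and "curv2 (parallel_surface a z) p = parallel_g a (\<lambda>_. curv1 z p) (\<lambda>_. curv2 z p) x"
  using assms(3) coeff_pos[OF assms(1)]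
  by (simp_all add: parallel_surface_forms[OF assms(1,2)] curv1_def[of "parallel_surface a z"]
      curv2_def[of "parallel_surface a z"] parallel_f_def parallel_g_def parallel_sign_def power2_eq_square)

end

text \<open>Over the common denominator the terms \<open>a * f x * g x\<close> cancel, and the sign
  turns the denominator into its absolute value. Hence the orientation by \<open>\<epsilon>\<close>
  keeps the difference of the principal curvatures positive.\<close>

lemma parallel_f_minus_parallel_g:
  assumes "(1 - a * f x) * (1 - a * g x) \<noteq> 0"
  shows "parallel_f a f g x - parallel_g a f g x = (f x - g x) / \<bar>(1 - a * f x) * (1 - a * g x)\<bar>"
proof -
  let ?d = "(1 - a * f x) * (1 - a * g x)"
  have nz: "1 - a * f x \<noteq> 0" "1 - a * g x \<noteq> 0" using assms by auto
  have "parallel_f a f g x - parallel_g a f g x = sgn ?d * (f x / (1 - a * f x) - g x / (1 - a * g x))"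
    by (simp add: parallel_f_def parallel_g_def parallel_sign_def right_diff_distrib)
  also have "f x / (1 - a * f x) - g x / (1 - a * g x) = (f x - g x) / ?d"
    by (simp add: diff_frac_eq[OF nz] right_diff_distrib mult.left_commute)
  also have "sgn ?d * ((f x - g x) / ?d) = (f x - g x) / \<bar>?d\<bar>"
    using assms by (cases "?d > 0") (simp_all add: sgn_real_def minus_divide_left)
  finally show ?thesis .
qed

lemma principal_surface_parallel:
  assumes S: "principal_surface (Suc k) D z" and k: "k \<ge> 2"
    and D': "param_domain D'" "D' \<subseteq> D"
    and nz: "\<forall>p\<in>D'. (1 - a * curv1 z p) * (1 - a * curv2 z p) \<noteq> 0"
  shows "principal_surface k D' (parallel_surface a z)"
  unfolding principal_surface_def
proof (intro conjI ballI)
  have k1: "k \<ge> 1" using k by simp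
  note lem = S k1
  show "param_domain D'" by fact
  show "Ck_on k D' (parallel_surface a z)"
    using Ck_on_parallel_surface[OF lem] D'(2) by (rule Ck_on_subset)
  fix p assume p': "p \<in> D'"
  then have p: "p \<in> D" using D' by auto
  have nz': "(1 - a * curv1 z p) * (1 - a * curv2 z p) \<noteq> 0" using nz p' by blast
  show "cross3 (pdu (parallel_surface a z) p) (pdv (parallel_surface a z) p) \<noteq> 0"
    using nz' principal_surface_cross[OF lem p]
    by (simp add: pd_parallel_surface[OF lem p] cross_mult_left cross_mult_right)
  show "coeff_F (parallel_surface a z) p = 0" "coeff_M (parallel_surface a z) p = 0"
    using parallel_surface_forms[OF lem p k] by auto
  have "curv1 z p - curv2 z p > 0" using S p by (auto simp: principal_surface_def)
  then show "curv1 (parallel_surface a z) p - curv2 (parallel_surface a z) p > 0"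
    using nz' parallel_f_minus_parallel_g[of a "\<lambda>_. curv1 z p" 0 "\<lambda>_. curv2 z p"]
    by (simp only: curv_parallel_surface[OF lem p k nz', of 0]) simp
qed

section \<open>The Weingarten functions of a parallel surface\<close>

lemma not_local_extremum_along_curve:
  fixes h :: "real \<Rightarrow> real"
  assumes "(h has_real_derivative m) (at x)" "m \<noteq> 0" "open A" "x \<in> A"
  obtains y y' where "y \<in> A" "y' \<in> A" "h y < h x" "h x < h y'"
proof -
  obtain e where e: "e > 0" "ball x e \<subseteq> A" using assms(3,4) open_contains_ball by blast
  have near: "x + r \<in> A" "x - r \<in> A" if "0 < r" "r < e" for r
    using e that by (auto simp: dist_real_def subset_iff)
  show thesis
  proof (cases "m > 0")
    case True
    obtain d1 where d1: "d1 > 0" "\<And>r. 0 < r \<Longrightarrow> r < d1 \<Longrightarrow> h x < h (x + r)"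
      using DERIV_pos_inc_right[OF assms(1) True] by auto
    obtain d2 where d2: "d2 > 0" "\<And>r. 0 < r \<Longrightarrow> r < d2 \<Longrightarrow> h (x - r) < h x"
      using DERIV_pos_inc_left[OF assms(1) True] by auto
    obtain r where r: "0 < r" "r < min e (min d1 d2)"
      using dense[of 0 "min e (min d1 d2)"] e d1 d2 by auto
    show ?thesis using r near[of r] d1(2)[of r] d2(2)[of r] by (intro that[of "x - r" "x + r"]) auto
  next
    case False
    then have m: "m < 0" using assms by simp
    obtain d1 where d1: "d1 > 0" "\<And>r. 0 < r \<Longrightarrow> r < d1 \<Longrightarrow> h (x + r) < h x"
      using DERIV_neg_dec_right[OF assms(1) m] by auto
    obtain d2 where d2: "d2 > 0" "\<And>r. 0 < r \<Longrightarrow> r < d2 \<Longrightarrow> h x < h (x - r)"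
      using DERIV_neg_dec_left[OF assms(1) m] by auto
    obtain r where r: "0 < r" "r < min e (min d1 d2)"
      using dense[of 0 "min e (min d1 d2)"] e d1 d2 by auto
    show ?thesis using r near[of r] d1(2)[of r] d2(2)[of r] by (intro that[of "x + r" "x - r"]) auto
  qed
qed

text \<open>Since \<open>\<nu>\<close> is merely differentiable, the argument is one-dimensional:
  along a coordinate line with nonzero partial derivative, \<open>\<nu>\<close> takes both smaller
  and larger values near \<open>p\<close>. The image is an interval by connectedness, and an
  interval in which every element lies strictly between two others is open.\<close>

lemma open_image_pd_nonzero:
  fixes \<nu> :: "real \<times> real \<Rightarrow> real"
  assumes D: "open D" "connected D" and \<nu>: "\<nu> differentiable_on D"
    and nz: "\<forall>p\<in>D. (pdu \<nu> p, pdv \<nu> p) \<noteq> (0, 0)"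
  shows "open (\<nu> ` D)" "is_interval (\<nu> ` D)"
proof -
  show int: "is_interval (\<nu> ` D)"
    using D \<nu> by (simp add: is_interval_connected_1 connected_continuous_image differentiable_imp_continuous_on)
  have "\<exists>y\<in>\<nu> ` D. \<exists>y'\<in>\<nu> ` D. y < \<nu> p \<and> \<nu> p < y'" if p: "p \<in> D" for p
  proof -
    obtain A B where AB: "open A" "open B" "fst p \<in> A" "snd p \<in> B" "A \<times> B \<subseteq> D"
      using open_prod_elim[OF D(1) p] by (metis mem_Times_iff)
    have d: "\<nu> differentiable (at p)" using \<nu> p D(1) by (simp add: differentiable_on_eq_differentiable_at)
    show ?thesis
    proof (cases "pdu \<nu> p = 0")
      case False
      obtain y y' where "y \<in> A" "y' \<in> A" "\<nu> (y, snd p) < \<nu> p" "\<nu> p < \<nu> (y', snd p)"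
        using not_local_extremum_along_curve[OF _ False AB(1,3), of "\<lambda>s. \<nu> (s, snd p)"]
          has_vector_derivative_pdu[OF d] by (auto simp: has_real_derivative_iff_has_vector_derivative)
      moreover from this have "(y, snd p) \<in> D" "(y', snd p) \<in> D" using AB by auto
      ultimately show ?thesis by blast
    next
      case True
      then have "pdv \<nu> p \<noteq> 0" using nz p by auto
      then obtain y y' where "y \<in> B" "y' \<in> B" "\<nu> (fst p, y) < \<nu> p" "\<nu> p < \<nu> (fst p, y')"
        using not_local_extremum_along_curve[OF _ _ AB(2,4), of "\<lambda>t. \<nu> (fst p, t)" "pdv \<nu> p"]
          has_vector_derivative_pdv[OF d] by (auto simp: has_real_derivative_iff_has_vector_derivative)
      moreover from this have "(fst p, y) \<in> D" "(fst p, y') \<in> D" using AB by auto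
      ultimately show ?thesis by blast
    qed
  qed
  then have "\<exists>y\<in>\<nu> ` D. \<exists>y'\<in>\<nu> ` D. y < x \<and> x < y'" if "x \<in> \<nu> ` D" for x
    using that by auto
  then have "\<exists>T. open T \<and> x \<in> T \<and> T \<subseteq> \<nu> ` D" if x: "x \<in> \<nu> ` D" for x
  proof -
    from \<open>x \<in> \<nu> ` D \<Longrightarrow> _\<close> x obtain y y' where "y \<in> \<nu> ` D" "y' \<in> \<nu> ` D" "y < x" "x < y'" by blast
    moreover from this have "{y<..<y'} \<subseteq> \<nu> ` D"
      using int unfolding is_interval_1 by (meson greaterThanLessThan_iff less_imp_le subsetI)
    ultimately show ?thesis by (intro exI[of _ "{y<..<y'}"]) auto
  qed
  then show "open (\<nu> ` D)" by (subst open_subopen) blast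
qed

section \<open>Derivatives and antiderivatives for \<open>parallel_f\<close> and
  \<open>parallel_g\<close>\<close>

lemma sgn_eq_on_interval:
  fixes h :: "real \<Rightarrow> real"
  assumes "is_interval I" "continuous_on I h" "\<And>x. x \<in> I \<Longrightarrow> h x \<noteq> 0" "x \<in> I" "y \<in> I"
  shows "sgn (h x) = sgn (h y)"
proof (rule ccontr)
  assume ne: "sgn (h x) \<noteq> sgn (h y)"
  have "connected (h ` I)"
    using assms by (simp add: connected_continuous_image is_interval_connected_1)
  moreover have "h x < 0 \<and> 0 < h y \<or> h y < 0 \<and> 0 < h x"
    using ne assms(3)[OF assms(4)] assms(3)[OF assms(5)] by (auto simp: sgn_real_def split: if_splits)
  ultimately have "0 \<in> h ` I"
    using assms(4,5) unfolding connected_iff_interval by (meson imageI less_imp_le)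
  then show False using assms(3) by force
qed

text \<open>The sign is symmetric in \<open>f\<close> and \<open>g\<close>. Every result on
  \<open>parallel_f\<close> thereby becomes one on \<open>parallel_g\<close> by interchanging the
  two functions.\<close>

lemma parallel_swap:
  "parallel_g a f g = parallel_f a g f"
  by (auto simp: parallel_g_def parallel_f_def parallel_sign_def mult.commute)

text \<open>On \<open>I\<close> the sign can be frozen at its value at \<open>x\<close>, and what
  remains is the map \<open>t / (1 - a * t)\<close>, with derivative
  \<open>1 / (1 - a * t)^2\<close>, applied to \<open>f\<close>. As \<open>I\<close> is open,
  agreement on \<open>I\<close> determines the full derivative at \<open>x\<close>.\<close>

lemma has_derivative_parallel_f:
  assumes I: "is_interval I" "open I" "x \<in> I"
    and d: "\<And>y. y \<in> I \<Longrightarrow> f differentiable (at y)" "\<And>y. y \<in> I \<Longrightarrow> g differentiable (at y)"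
    and nz: "\<And>y. y \<in> I \<Longrightarrow> (1 - a * f y) * (1 - a * g y) \<noteq> 0"
  shows "(parallel_f a f g has_real_derivative parallel_sign a f g x * deriv f x / (1 - a * f x)\<^sup>2) (at x)"
proof -
  have "continuous_on I f" "continuous_on I g"
    using d by (auto intro!: continuous_at_imp_continuous_on differentiable_imp_continuous_within)
  then have "continuous_on I (\<lambda>y. (1 - a * f y) * (1 - a * g y))" by (intro continuous_intros)
  from sgn_eq_on_interval[OF I(1) this nz]
  have sign: "parallel_sign a f g y = parallel_sign a f g x" if "y \<in> I" for y
    unfolding parallel_sign_def using that I(3) by blast
  have "(f has_real_derivative deriv f x) (at x)"
    using d(1)[OF I(3)] by (simp add: DERIV_deriv_iff_real_differentiable)
  then have "((\<lambda>y. parallel_sign a f g x * f y / (1 - a * f y)) has_real_derivative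
      parallel_sign a f g x * deriv f x / (1 - a * f x)\<^sup>2) (at x)"
    using nz[OF I(3)] by (auto intro!: derivative_eq_intros simp: field_simps power2_eq_square)
  then show ?thesis
    by (rule has_field_derivative_transform_within_open[OF _ I(2,3)])
      (simp add: parallel_f_def sign)
qed

text \<open>Writing the function as half the logarithm of \<open>t^2\<close> treats both signs of
  \<open>c\<close> at once.\<close>

lemma DERIV_ln_abs:
  fixes c :: real
  assumes "c \<noteq> 0"
  shows "((\<lambda>t. ln \<bar>t\<bar>) has_real_derivative 1 / c) (at c)"
proof -
  have "((\<lambda>t. ln (t\<^sup>2) / 2) has_real_derivative 1 / c) (at c)"
    using assms by (auto intro!: derivative_eq_intros simp: power2_eq_square zero_less_mult_iff)
  moreover have "ln (t\<^sup>2) / 2 = ln \<bar>t\<bar>" if "t \<in> - {0}" for t :: real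
    using that ln_realpow[of "\<bar>t\<bar>" 2] by simp
  ultimately show ?thesis
    using assms by (elim has_field_derivative_transform_within_open[of _ _ _ "- {0}"]) auto
qed

lemma weingarten_function_antiderivative:
  assumes I: "is_interval I" "open I"
    and d: "\<And>y. y \<in> I \<Longrightarrow> f differentiable (at y)" "\<And>y. y \<in> I \<Longrightarrow> g differentiable (at y)"
    and nz: "\<And>y. y \<in> I \<Longrightarrow> (1 - a * f y) * (1 - a * g y) \<noteq> 0"
    and fg: "\<And>y. y \<in> I \<Longrightarrow> f y - g y \<noteq> 0"
    and \<Phi>: "(\<Phi> has_real_derivative deriv f x / (f x - g x)) (at x within I)" and x: "x \<in> I"
  shows "((\<lambda>y. \<Phi> y - ln \<bar>1 - a * f y\<bar>) has_real_derivative
    deriv (parallel_f a f g) x / (parallel_f a f g x - parallel_g a f g x)) (at x within I)"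
proof -
  have nzx: "1 - a * f x \<noteq> 0" "1 - a * g x \<noteq> 0" using nz[OF x] by auto
  have "(f has_real_derivative deriv f x) (at x within I)"
    using d(1)[OF x] by (simp add: DERIV_deriv_iff_real_differentiable has_field_derivative_at_within)
  then have "((\<lambda>y. 1 - a * f y) has_real_derivative - a * deriv f x) (at x within I)"
    by (auto intro!: derivative_eq_intros)
  moreover have "((\<lambda>t. ln \<bar>t\<bar>) has_real_derivative 1 / (1 - a * f x)) (at (1 - a * f x))"
    using nzx(1) by (rule DERIV_ln_abs)
  ultimately have "((\<lambda>y. ln \<bar>1 - a * f y\<bar>) has_real_derivative 1 / (1 - a * f x) * (- a * deriv f x)) (at x within I)"
    by (rule DERIV_chain2[rotated])
  from DERIV_diff[OF \<Phi> this]
  have main: "((\<lambda>y. \<Phi> y - ln \<bar>1 - a * f y\<bar>) has_real_derivative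
      deriv f x / (f x - g x) + a * deriv f x / (1 - a * f x)) (at x within I)"
    by simp
  have "deriv (parallel_f a f g) x / (parallel_f a f g x - parallel_g a f g x)
      = (parallel_sign a f g x * \<bar>(1 - a * f x) * (1 - a * g x)\<bar>) * deriv f x / ((1 - a * f x)\<^sup>2 * (f x - g x))"
    using nz[OF x] fg[OF x]
    by (simp add: DERIV_imp_deriv[OF has_derivative_parallel_f[OF I x d nz]] parallel_f_minus_parallel_g)
  \<comment> \<open>The sign coming from the derivative meets the absolute value coming from the
    difference of the curvatures; together they restore the plain product, and the quotient no
    longer contains the sign.\<close>
  also have "parallel_sign a f g x * \<bar>(1 - a * f x) * (1 - a * g x)\<bar> = (1 - a * f x) * (1 - a * g x)"
    unfolding parallel_sign_def by (rule sgn_mult_abs)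
  also have "(1 - a * f x) * (1 - a * g x) * deriv f x / ((1 - a * f x)\<^sup>2 * (f x - g x))
      = deriv f x / (f x - g x) + a * deriv f x / (1 - a * f x)"
    using nzx fg[OF x] by (simp add: divide_simps power2_eq_square) (simp add: algebra_simps)
  finally show ?thesis using main by simp
qed

lemma sqrt_parallel_coeff:
  fixes c e :: real
  assumes "c \<noteq> 0"
  shows "sqrt (c\<^sup>2 * e) * exp (t - ln \<bar>c\<bar>) = sqrt e * exp t"
  using assms by (simp add: real_sqrt_mult exp_diff)

text \<open>Removing the excluded points may disconnect \<open>D\<close>, while a surface is
  parametrized over a connected set; \<open>D'\<close> stands for any domain inside \<open>D\<close>
  that avoids them. The drop from \<open>Suc k\<close> to \<open>k\<close> is the order lost in the
  normal, and \<open>k \<ge> 2\<close> leaves the parallel surface second derivatives.\<close>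

theorem proposition3p1:
  fixes z :: "real \<times> real \<Rightarrow> real^3" and D D' :: "(real \<times> real) set"
    and f g :: "real \<Rightarrow> real" and \<nu> :: "real \<times> real \<Rightarrow> real"
    and a :: real and k :: nat
  assumes "k \<ge> 2"
    and "natural_principal_parameters (Suc k) D z f g \<nu>"
    and "a \<noteq> 0"
    and "param_domain D'" and "D' \<subseteq> D"
    and "\<forall>p\<in>D'. (1 - a * curv1 z p) * (1 - a * curv2 z p) \<noteq> 0"
  shows "natural_principal_parameters k D' (parallel_surface a z)
           (parallel_f a f g) (parallel_g a f g) \<nu>"
proof -
  note nat = assms(2)[unfolded natural_principal_parameters_def]
  have W: "weingarten_surface (Suc k) D z f g \<nu>" using nat by blast
  then have S: "principal_surface (Suc k) D z" by (simp add: weingarten_surface_def)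
  have k1: "k \<ge> 1" using assms(1) by simp
  \<comment> \<open>The interval on which \<open>f\<close> and \<open>g\<close> are given may
    contain zeros of \<open>1 - a * f x\<close> or \<open>1 - a * g x\<close>. On the values taken
    over \<open>D'\<close> these are excluded, so the new Weingarten functions are considered
    there.\<close>
  define I where "I = \<nu> ` D'"
  have "I \<subseteq> \<nu> ` D" using assms(5) by (auto simp: I_def)
  have \<nu>: "\<nu> differentiable_on D'" "\<forall>p\<in>D'. (pdu \<nu> p, pdv \<nu> p) \<noteq> (0, 0)"
    using W assms(5) by (auto simp: weingarten_surface_def intro: differentiable_on_subset)
  have I: "is_interval I" "open I"
    unfolding I_def using open_image_pd_nonzero[OF _ _ \<nu>] assms(4) by (auto simp: param_domain_def)
  have d: "f differentiable (at x)" "g differentiable (at x)"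
    and fg: "f x - g x \<noteq> 0" "g x - f x \<noteq> 0" and dfg: "deriv f x \<noteq> 0" "deriv g x \<noteq> 0"
    if x: "x \<in> I" for x
  proof -
    obtain J where "\<nu> ` D \<subseteq> J" "\<forall>x\<in>J. f differentiable (at x) \<and> g differentiable (at x) \<and>
               f x - g x \<noteq> 0 \<and> deriv f x * deriv g x \<noteq> 0"
      using W unfolding weingarten_surface_def by blast
    then show "f differentiable (at x)" "g differentiable (at x)" "f x - g x \<noteq> 0" "g x - f x \<noteq> 0"
      "deriv f x \<noteq> 0" "deriv g x \<noteq> 0"
      using x \<open>I \<subseteq> \<nu> ` D\<close> by force+
  qed
  have curv: "curv1 z p = f (\<nu> p)" "curv2 z p = g (\<nu> p)" if "p \<in> D" for p
    using W that by (auto simp: weingarten_surface_def)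
  have nz: "(1 - a * f x) * (1 - a * g x) \<noteq> 0" "(1 - a * g x) * (1 - a * f x) \<noteq> 0" if "x \<in> I" for x
  proof -
    obtain p where "p \<in> D'" "x = \<nu> p" using \<open>x \<in> I\<close> unfolding I_def by blast
    with assms(5,6) curv[of p] show "(1 - a * f x) * (1 - a * g x) \<noteq> 0"
      by (metis subsetD)
    then show "(1 - a * g x) * (1 - a * f x) \<noteq> 0" by (simp only: mult.commute not_False_eq_True)
  qed
  \<comment> \<open>The rule for \<open>parallel_g\<close> is the one for \<open>parallel_f\<close>
    with \<open>f\<close> and \<open>g\<close> interchanged. Its sign therefore appears as
    \<open>parallel_sign a g f\<close>, which is why \<open>nz\<close> and \<open>sign\<close> list
    both orders.\<close>
  note df = has_derivative_parallel_f[OF I _ d nz(1)]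
    and dg = has_derivative_parallel_f[OF I _ d(2,1) nz(2), folded parallel_swap]
  have sign: "parallel_sign a f g x \<noteq> 0" "parallel_sign a g f x \<noteq> 0" if "x \<in> I" for x
    using nz[OF that] by (auto simp: parallel_sign_def sgn_zero_iff)
  have "parallel_f a f g differentiable (at x) \<and> parallel_g a f g differentiable (at x) \<and>
      parallel_f a f g x - parallel_g a f g x \<noteq> 0 \<and> deriv (parallel_f a f g) x * deriv (parallel_g a f g) x \<noteq> 0"
    if x: "x \<in> I" for x
  proof (intro conjI)
    show "parallel_f a f g differentiable (at x)" "parallel_g a f g differentiable (at x)"
      using df[OF x] dg[OF x] by (auto simp: real_differentiable_def)
    show "parallel_f a f g x - parallel_g a f g x \<noteq> 0"
      using nz(1)[OF x] fg(1)[OF x] by (simp add: parallel_f_minus_parallel_g)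
    show "deriv (parallel_f a f g) x * deriv (parallel_g a f g) x \<noteq> 0"
      using sign[OF x] dfg[OF x] nz(1)[OF x]
      by (simp add: DERIV_imp_deriv[OF df[OF x]] DERIV_imp_deriv[OF dg[OF x]])
  qed
  moreover have "curv1 (parallel_surface a z) p = parallel_f a f g (\<nu> p)"
    "curv2 (parallel_surface a z) p = parallel_g a f g (\<nu> p)" if "p \<in> D'" for p
  proof -
    have p: "p \<in> D" using that assms(5) by auto
    note curv_parallel_surface[OF S k1 p assms(1) bspec[OF assms(6) that], of "\<nu> p"]
    then show "curv1 (parallel_surface a z) p = parallel_f a f g (\<nu> p)"
      "curv2 (parallel_surface a z) p = parallel_g a f g (\<nu> p)"
      by (simp_all add: parallel_f_def parallel_g_def parallel_sign_def curv[OF p])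
  qed
  moreover have "principal_surface k D' (parallel_surface a z)"
    by (rule principal_surface_parallel[OF S assms(1,4,5,6)])
  ultimately have "weingarten_surface k D' (parallel_surface a z) (parallel_f a f g) (parallel_g a f g) \<nu>"
    unfolding weingarten_surface_def using I \<nu> by (auto simp: I_def intro!: exI[of _ "\<nu> ` D'"])
  moreover have "\<exists>\<Phi>. (\<forall>x\<in>\<nu> ` D'. (\<Phi> has_real_derivative
        deriv (parallel_f a f g) x / (parallel_f a f g x - parallel_g a f g x)) (at x within \<nu> ` D')) \<and>
      (\<lambda>p. sqrt (coeff_E (parallel_surface a z) p) * exp (\<Phi> (\<nu> p))) constant_on D'"
  proof -
    obtain \<Phi> c where \<Phi>: "\<forall>x\<in>\<nu> ` D. (\<Phi> has_real_derivative deriv f x / (f x - g x)) (at x within \<nu> ` D)"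
      and c: "\<forall>p\<in>D. sqrt (coeff_E z p) * exp (\<Phi> (\<nu> p)) = c"
      using nat unfolding constant_on_def by blast
    have "((\<lambda>y. \<Phi> y - ln \<bar>1 - a * f y\<bar>) has_real_derivative
        deriv (parallel_f a f g) x / (parallel_f a f g x - parallel_g a f g x)) (at x within I)"
      if x: "x \<in> I" for x
    proof -
      have "x \<in> \<nu> ` D" using x \<open>I \<subseteq> \<nu> ` D\<close> by blast
      then have "(\<Phi> has_real_derivative deriv f x / (f x - g x)) (at x within I)"
        using \<Phi> \<open>I \<subseteq> \<nu> ` D\<close> DERIV_subset by blast
      from weingarten_function_antiderivative[OF I d nz(1) fg(1) this x]
      show ?thesis .
    qed
    \<comment> \<open>With this choice of antiderivative the value itself is preserved: the constant
      \<open>c\<close> of the original surface serves for the parallel one too.\<close>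
    moreover have "sqrt (coeff_E (parallel_surface a z) p) * exp (\<Phi> (\<nu> p) - ln \<bar>1 - a * f (\<nu> p)\<bar>) = c"
      if "p \<in> D'" for p
    proof -
      have p: "p \<in> D" using that assms(5) by auto
      have "1 - a * f (\<nu> p) \<noteq> 0" using nz that by (auto simp: I_def)
      then show ?thesis
        using c p by (simp add: parallel_surface_forms[OF S k1 p assms(1)] curv[OF p] sqrt_parallel_coeff)
    qed
    ultimately show ?thesis
      unfolding constant_on_def I_def by (intro exI[of _ "\<lambda>y. \<Phi> y - ln \<bar>1 - a * f y\<bar>"]) blast
  qed
  moreover have "\<exists>\<Psi>. (\<forall>x\<in>\<nu> ` D'. (\<Psi> has_real_derivative
        deriv (parallel_g a f g) x / (parallel_g a f g x - parallel_f a f g x)) (at x within \<nu> ` D')) \<and>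
      (\<lambda>p. sqrt (coeff_G (parallel_surface a z) p) * exp (\<Psi> (\<nu> p))) constant_on D'"
  proof -
    obtain \<Psi> c where \<Psi>: "\<forall>x\<in>\<nu> ` D. (\<Psi> has_real_derivative deriv g x / (g x - f x)) (at x within \<nu> ` D)"
      and c: "\<forall>p\<in>D. sqrt (coeff_G z p) * exp (\<Psi> (\<nu> p)) = c"
      using nat unfolding constant_on_def by blast
    have "((\<lambda>y. \<Psi> y - ln \<bar>1 - a * g y\<bar>) has_real_derivative
        deriv (parallel_g a f g) x / (parallel_g a f g x - parallel_f a f g x)) (at x within I)"
      if x: "x \<in> I" for x
    proof -
      have "x \<in> \<nu> ` D" using x \<open>I \<subseteq> \<nu> ` D\<close> by blast
      then have "(\<Psi> has_real_derivative deriv g x / (g x - f x)) (at x within I)"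
        using \<Psi> \<open>I \<subseteq> \<nu> ` D\<close> DERIV_subset by blast
      from weingarten_function_antiderivative[OF I d(2,1) nz(2) fg(2) this x]
      show ?thesis unfolding parallel_swap .
    qed
    moreover have "sqrt (coeff_G (parallel_surface a z) p) * exp (\<Psi> (\<nu> p) - ln \<bar>1 - a * g (\<nu> p)\<bar>) = c"
      if "p \<in> D'" for p
    proof -
      have p: "p \<in> D" using that assms(5) by auto
      have "1 - a * g (\<nu> p) \<noteq> 0" using nz that by (auto simp: I_def)
      then show ?thesis
        using c p by (simp add: parallel_surface_forms[OF S k1 p assms(1)] curv[OF p] sqrt_parallel_coeff)
    qed
    ultimately show ?thesis
      unfolding constant_on_def I_def by (intro exI[of _ "\<lambda>y. \<Psi> y - ln \<bar>1 - a * g y\<bar>"]) blast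
  qed
  ultimately show ?thesis unfolding natural_principal_parameters_def by blast
qed

end
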